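(* Let $m\ge 1$. For non-preemptive makespan minimization on $m$ identical machines with testing, no deterministic online algorithm is $c$-competitive for any $c<2-\frac{1}{m}$. This holds even when restricted to instances in which all testing times equal $1$.
   Context: Scheduling with testing on $m$ identical parallel machines: there are $n$ jobs; each job $j$ has a testing time $t_j\ge 0$, an upper bound $u_j\ge 0$ and a processing time $p_j$ with $0\le p_j\le u_j$. A job can either be run untested, occupying a machine for time $u_j$, or be tested and then executed, occupying a machine for total time $t_j+p_j$; the value $p_j$ is revealed to the algorithm only when the test of $j$ is completed. Initially the algorithm knows $m$, $n$ and all $t_j,u_j$ (and may order the jobs using them), but not the $p_j$. In the non-preemptive setting each job is assigned to a single machine and run there without interruption (test followed directly by execution if tested). The objective is the makespan (maximum machine load). $\mathrm{OPT}$ denotes the minimum makespan achievable by an offline scheduler knowing all $p_j$ (so job $j$ needs time $\rho_j=\min(t_j+p_j,u_j)$ in the optimum). A deterministic algorithm is $c$-competitive if its makespan $\mathrm{ALG}$ satisfies $\mathrm{ALG}\le c\cdot\mathrm{OPT}$ on every instance. *)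

theory Defs
  imports Complex_Main
begin

record job =
  test_time :: real
  upper_bound :: real
  proc_time :: real

type_synonym inst = "job list"

definition valid_instances :: "inst set" where
  "valid_instances =
     {I. \<forall>x\<in>set I. 0 \<le> test_time x \<and> 0 \<le> upper_bound x \<and> 0 \<le> proc_time x \<and> proc_time x \<le> upper_bound x}"

definition unit_test_instances :: "inst set" where
  "unit_test_instances = {I \<in> valid_instances. \<forall>x\<in>set I. test_time x = 1}"

text \<open>What is known initially; the number of jobs is the length of the list.\<close>

definition public_data :: "inst \<Rightarrow> (real \<times> real) list" where
  "public_data I = map (\<lambda>x. (test_time x, upper_bound x)) I"

text \<open>Jobs are the indices below \<open>length I\<close>, machines the numbers below \<open>m\<close>.
  A decision starts one job on one machine at a point in time, either untested or with a test
  that is directly followed by the execution. A schedule lists its decisions in the order in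
  which they are taken.\<close>

record decision =
  the_job :: nat
  the_machine :: nat
  the_start :: real
  tested :: bool

type_synonym schedule = "decision list"

definition duration :: "inst \<Rightarrow> decision \<Rightarrow> real" where
  "duration I d =
     (let x = I ! the_job d in
      if tested d then test_time x + proc_time x else upper_bound x)"

definition feasible :: "nat \<Rightarrow> inst \<Rightarrow> schedule \<Rightarrow> bool" where
  "feasible m I \<sigma> \<longleftrightarrow>
     distinct (map the_job \<sigma>) \<and> set (map the_job \<sigma>) = {..<length I} \<and>
     (\<forall>d\<in>set \<sigma>. the_machine d < m \<and> 0 \<le> the_start d) \<and>
     sorted (map the_start \<sigma>) \<and>
     (\<forall>k<length \<sigma>. \<forall>i<k. the_machine (\<sigma> ! i) = the_machine (\<sigma> ! k) \<longrightarrow>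
        the_start (\<sigma> ! i) + duration I (\<sigma> ! i) \<le> the_start (\<sigma> ! k))"

text \<open>The load of a machine is the total time for which it is occupied. Idle time is allowed but
  not counted; this can only favour the algorithm, and it makes no difference for the offline
  optimum.\<close>

definition machine_load :: "inst \<Rightarrow> schedule \<Rightarrow> nat \<Rightarrow> real" where
  "machine_load I \<sigma> i = (\<Sum>d\<leftarrow>filter (\<lambda>d. the_machine d = i) \<sigma>. duration I d)"

definition makespan :: "nat \<Rightarrow> inst \<Rightarrow> schedule \<Rightarrow> real" where
  "makespan m I \<sigma> = Max (machine_load I \<sigma> ` {..<m})"

definition opt :: "nat \<Rightarrow> inst \<Rightarrow> real" where
  "opt m I = Inf (makespan m I ` {\<sigma>. feasible m I \<sigma>})"

text \<open>Two instances with the same public data look alike at time \<open>\<tau>\<close> after the decisions \<open>ds\<close>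
  if every test started in \<open>ds\<close> and completed by time \<open>\<tau>\<close> reveals the same processing time
  in both.\<close>

definition same_revealed :: "inst \<Rightarrow> inst \<Rightarrow> decision list \<Rightarrow> real \<Rightarrow> bool" where
  "same_revealed I I' ds \<tau> \<longleftrightarrow>
     (\<forall>d\<in>set ds. tested d \<and> the_start d + test_time (I ! the_job d) \<le> \<tau> \<longrightarrow>
        proc_time (I ! the_job d) = proc_time (I' ! the_job d))"

text \<open>A deterministic algorithm maps every instance of the class \<open>K\<close> to a feasible schedule. It is
  online if each decision is determined by the public data, the earlier decisions and the
  processing times revealed by the time of the decision. Only tests among the earlier decisions
  count as revealed, so that a test of duration 0 is not known to the decision that starts it.\<close>

definition online_algorithm :: "nat \<Rightarrow> inst set \<Rightarrow> (inst \<Rightarrow> schedule) \<Rightarrow> bool" where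
  "online_algorithm m K A \<longleftrightarrow>
     (\<forall>I\<in>K. feasible m I (A I)) \<and>
     (\<forall>I\<in>K. \<forall>I'\<in>K. \<forall>k<length I.
        public_data I = public_data I' \<and> take k (A I) = take k (A I') \<and>
        same_revealed I I' (take k (A I)) (the_start (A I ! k))
        \<longrightarrow> A I ! k = A I' ! k)"

definition competitive :: "nat \<Rightarrow> inst set \<Rightarrow> real \<Rightarrow> (inst \<Rightarrow> schedule) \<Rightarrow> bool" where
  "competitive m K c A \<longleftrightarrow> (\<forall>I\<in>K. makespan m I (A I) \<le> c * opt m I)"

end

theory Submission
  imports Defs "HOL-Library.Product_Lexorder"
begin

text \<open>The adversary presents \<open>m (m - 1) + 1\<close> jobs with testing time \<open>1\<close> and upper bound \<open>2 m\<close>,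
  which all look alike. If every processing time is \<open>0\<close>, the optimum is at most \<open>m\<close>, so running
  some job untested is too expensive. If all jobs are tested, some machine receives at least \<open>m\<close>
  of them, and the last of these jobs can be given processing time \<open>m - 1\<close> without the algorithm
  noticing before the job is placed. That machine then has load at least \<open>(m - 1) + m\<close>, while the
  optimum is still at most \<open>m\<close>: the long job gets a machine for itself and the other \<open>m (m - 1)\<close>
  jobs are spread evenly over the remaining machines.\<close>

lemma pigeonhole_count_list:
  assumes "set xs \<subseteq> X" "finite X" "k * card X < length xs"
  shows "\<exists>x\<in>X. k < count_list xs x"
proof (rule ccontr)
  assume "\<not> (\<exists>x\<in>X. k < count_list xs x)"
  then have "sum (count_list xs) X \<le> card X * k"
    by (intro sum_bounded_above[where K = k, simplified]) (auto simp: not_less)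
  then show False
    using assms by (simp add: sum_count_set mult.commute)
qed

lemma exists_balanced_map:
  assumes "finite X" "card X \<le> k * w"
  obtains f where "\<And>x. x \<in> X \<Longrightarrow> f x < w" "\<And>i. card {x \<in> X. f x = i} \<le> k"
proof -
  obtain h where h: "bij_betw h X {0..<card X}"
    using ex_bij_betw_finite_nat[OF \<open>finite X\<close>] by blast
  show thesis
  proof (rule that[of "\<lambda>x. h x div k"])
    fix x assume "x \<in> X"
    then have "h x < card X"
      using bij_betwE[OF h] by simp
    also have "\<dots> \<le> w * k"
      using assms(2) by (simp add: mult.commute)
    finally show "h x div k < w"
      by (rule less_mult_imp_div_less)
  next
    fix i
    show "card {x \<in> X. h x div k = i} \<le> k"
    proof (cases "k = 0")
      case False
      have "inj_on h {x \<in> X. h x div k = i}"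
        using h by (auto simp: bij_betw_def intro: inj_on_subset)
      moreover have "h ` {x \<in> X. h x div k = i} \<subseteq> {i * k..<i * k + k}"
        using False by (auto simp: dividend_less_div_times add.commute)
      ultimately show ?thesis
        using card_inj_on_le[of h "{x \<in> X. h x div k = i}" "{i * k..<i * k + k}"] by simp
    qed (use assms in simp)
  qed
qed


subsection \<open>Loads, makespan and optimum\<close>

lemma unit_test_instances_subset_valid: "unit_test_instances \<subseteq> valid_instances"
  by (auto simp: unit_test_instances_def)

lemma feasible_length: "feasible m I \<sigma> \<Longrightarrow> length \<sigma> = length I"
  unfolding feasible_def by (metis card_lessThan distinct_card length_map)

lemma feasible_job_less: "feasible m I \<sigma> \<Longrightarrow> d \<in> set \<sigma> \<Longrightarrow> the_job d < length I"
  by (auto simp: feasible_def)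

lemma feasible_append_Cons_job_neq:
  assumes "feasible m I (\<sigma> @ d # \<sigma>')" "e \<in> set \<sigma>"
  shows "the_job e \<noteq> the_job d"
proof -
  have "the_job d \<notin> the_job ` set \<sigma>"
    using assms(1) by (simp add: feasible_def)
  then show ?thesis
    using assms(2) by (metis imageI)
qed

lemma feasible_machine_less: "feasible m I \<sigma> \<Longrightarrow> d \<in> set \<sigma> \<Longrightarrow> the_machine d < m"
  by (simp add: feasible_def)

lemma duration_nonneg:
  assumes "I \<in> valid_instances" "the_job d < length I"
  shows "0 \<le> duration I d"
  using assms nth_mem[OF assms(2)] by (auto simp: duration_def valid_instances_def Let_def)

lemma feasible_duration_nonneg:
  assumes "I \<in> valid_instances" "feasible m I \<sigma>" "d \<in> set \<sigma>"
  shows "0 \<le> duration I d"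
  using assms by (intro duration_nonneg feasible_job_less)

lemma machine_load_Nil [simp]: "machine_load I [] i = 0"
  by (simp add: machine_load_def)

lemma machine_load_Cons [simp]:
  "machine_load I (d # \<sigma>) i =
     (if the_machine d = i then duration I d else 0) + machine_load I \<sigma> i"
  by (simp add: machine_load_def)

lemma machine_load_append [simp]:
  "machine_load I (\<sigma> @ \<sigma>') i = machine_load I \<sigma> i + machine_load I \<sigma>' i"
  by (simp add: machine_load_def)

lemma machine_load_nonneg:
  assumes "\<And>d. d \<in> set \<sigma> \<Longrightarrow> 0 \<le> duration I d"
  shows "0 \<le> machine_load I \<sigma> i"
  unfolding machine_load_def using assms by (intro sum_list_nonneg) auto

lemma machine_load_cong:
  assumes "\<And>d. d \<in> set \<sigma> \<Longrightarrow> duration I d = duration I' d"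
  shows "machine_load I \<sigma> i = machine_load I' \<sigma> i"
  unfolding machine_load_def using assms by (intro arg_cong[of _ _ sum_list] map_cong) auto

lemma machine_load_eq_0:
  "(\<And>d. d \<in> set \<sigma> \<Longrightarrow> the_machine d \<noteq> i) \<Longrightarrow> machine_load I \<sigma> i = 0"
  by (simp add: machine_load_def)

lemma count_list_mult_le_machine_load:
  assumes "\<And>d. d \<in> set \<sigma> \<Longrightarrow> r \<le> duration I d"
  shows "real (count_list (map the_machine \<sigma>) i) * r \<le> machine_load I \<sigma> i"
  using assms by (induction \<sigma>) (fastforce simp: algebra_simps)+

lemma machine_load_le_makespan: "i < m \<Longrightarrow> machine_load I \<sigma> i \<le> makespan m I \<sigma>"
  by (simp add: makespan_def)

lemma makespan_le_iff:
  assumes "m \<ge> 1"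
  shows "makespan m I \<sigma> \<le> b \<longleftrightarrow> (\<forall>i<m. machine_load I \<sigma> i \<le> b)"
  unfolding makespan_def using assms by (subst Max_le_iff) (auto simp: lessThan_empty_iff)

lemma duration_le_makespan:
  assumes "I \<in> valid_instances" "feasible m I \<sigma>" "d \<in> set \<sigma>"
  shows "duration I d \<le> makespan m I \<sigma>"
proof -
  have "duration I d \<le> machine_load I \<sigma> (the_machine d)"
    unfolding machine_load_def using assms
    by (intro member_le_sum_list) (auto intro: feasible_duration_nonneg)
  also have "\<dots> \<le> makespan m I \<sigma>"
    using assms by (intro machine_load_le_makespan feasible_machine_less)
  finally show ?thesis .
qed

lemma makespan_nonneg:
  assumes "m \<ge> 1" "I \<in> valid_instances" "feasible m I \<sigma>"
  shows "0 \<le> makespan m I \<sigma>"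
proof -
  have "0 \<le> machine_load I \<sigma> 0"
    using assms(2,3) by (intro machine_load_nonneg feasible_duration_nonneg)
  also have "\<dots> \<le> makespan m I \<sigma>"
    using assms(1) by (intro machine_load_le_makespan) simp
  finally show ?thesis .
qed

lemma opt_le_makespan:
  assumes "m \<ge> 1" "I \<in> valid_instances" "feasible m I \<sigma>"
  shows "opt m I \<le> makespan m I \<sigma>"
  unfolding opt_def using assms
  by (intro cInf_lower bdd_belowI[where m = 0]) (auto intro: makespan_nonneg)

lemma opt_nonneg:
  assumes "m \<ge> 1" "I \<in> valid_instances" "feasible m I \<sigma>"
  shows "0 \<le> opt m I"
  unfolding opt_def using assms
  by (intro cInf_greatest) (auto intro: makespan_nonneg)


subsection \<open>Offline schedules from assignments\<close>

definition offline_time :: "job \<Rightarrow> real" where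
  "offline_time x = min (test_time x + proc_time x) (upper_bound x)"

lemma offline_time_nonneg:
  "I \<in> valid_instances \<Longrightarrow> j < length I \<Longrightarrow> 0 \<le> offline_time (I ! j)"
  by (auto simp: valid_instances_def offline_time_def)

definition assigned_start :: "inst \<Rightarrow> (nat \<Rightarrow> nat) \<Rightarrow> nat \<Rightarrow> real" where
  "assigned_start I a j = (\<Sum>i | i < j \<and> a i = a j. offline_time (I ! i))"

definition assigned_decision :: "inst \<Rightarrow> (nat \<Rightarrow> nat) \<Rightarrow> nat \<Rightarrow> decision" where
  "assigned_decision I a j = \<lparr>the_job = j, the_machine = a j, the_start = assigned_start I a j,
     tested = (test_time (I ! j) + proc_time (I ! j) \<le> upper_bound (I ! j))\<rparr>"

text \<open>Jobs of duration \<open>0\<close> may share their start with a later job of the same machine, hence the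
  secondary key.\<close>

definition assignment_order :: "inst \<Rightarrow> (nat \<Rightarrow> nat) \<Rightarrow> nat list" where
  "assignment_order I a = sort_key (\<lambda>j. (assigned_start I a j, j)) [0..<length I]"

definition assignment_schedule :: "inst \<Rightarrow> (nat \<Rightarrow> nat) \<Rightarrow> schedule" where
  "assignment_schedule I a = map (assigned_decision I a) (assignment_order I a)"

lemma assigned_decision_sel [simp]:
  "the_job (assigned_decision I a j) = j"
  "the_machine (assigned_decision I a j) = a j"
  "the_start (assigned_decision I a j) = assigned_start I a j"
  by (simp_all add: assigned_decision_def)

lemma duration_assigned_decision [simp]:
  "duration I (assigned_decision I a j) = offline_time (I ! j)"
  by (simp add: duration_def assigned_decision_def offline_time_def Let_def)

lemma set_assignment_order [simp]: "set (assignment_order I a) = {..<length I}"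
  by (auto simp: assignment_order_def)

lemma distinct_assignment_order [simp]: "distinct (assignment_order I a)"
  by (simp add: assignment_order_def)

lemma sorted_assignment_order:
  "sorted_wrt (\<lambda>i j. (assigned_start I a i, i) \<le> (assigned_start I a j, j)) (assignment_order I a)"
  using sorted_sort_key[of "\<lambda>j. (assigned_start I a j, j)" "[0..<length I]"]
  unfolding assignment_order_def sorted_wrt_map .

lemma assigned_start_nonneg:
  assumes "I \<in> valid_instances" "j < length I"
  shows "0 \<le> assigned_start I a j"
  unfolding assigned_start_def using assms by (intro sum_nonneg offline_time_nonneg) auto

lemma assigned_start_add_le:
  assumes "I \<in> valid_instances" "i < j" "j < length I" "a i = a j"
  shows "assigned_start I a i + offline_time (I ! i) \<le> assigned_start I a j"
proof -
  have "assigned_start I a i + offline_time (I ! i)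
      = (\<Sum>l\<in>insert i {l. l < i \<and> a l = a i}. offline_time (I ! l))"
    by (simp add: assigned_start_def)
  also have "\<dots> \<le> assigned_start I a j"
    unfolding assigned_start_def using assms
    by (intro sum_mono2) (auto intro: offline_time_nonneg)
  finally show ?thesis .
qed

lemma assignment_order_no_overlap:
  assumes "I \<in> valid_instances"
  shows "sorted_wrt (\<lambda>i j. a i = a j \<longrightarrow>
    assigned_start I a i + offline_time (I ! i) \<le> assigned_start I a j) (assignment_order I a)"
proof -
  have "sorted_wrt (\<lambda>i j. (assigned_start I a i, i) \<le> (assigned_start I a j, j) \<and> i \<noteq> j)
      (assignment_order I a)"
    using sorted_assignment_order[of I a] distinct_assignment_order[of I a]
    by (auto simp: sorted_wrt_iff_nth_less nth_eq_iff_index_eq)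
  then show ?thesis
  proof (rule sorted_wrt_mono_rel[rotated], intro impI)
    fix i j
    assume ij: "i \<in> set (assignment_order I a)" "j \<in> set (assignment_order I a)" "a i = a j"
      and before: "(assigned_start I a i, i) \<le> (assigned_start I a j, j) \<and> i \<noteq> j"
    have "\<not> j < i"
    proof
      assume "j < i"
      then have "assigned_start I a j + offline_time (I ! j) \<le> assigned_start I a i"
        using ij assms by (intro assigned_start_add_le) auto
      moreover have "0 \<le> offline_time (I ! j)"
        using ij assms by (simp add: offline_time_nonneg)
      ultimately show False
        using before \<open>j < i\<close> by auto
    qed
    then show "assigned_start I a i + offline_time (I ! i) \<le> assigned_start I a j"
      using before ij assms by (intro assigned_start_add_le) auto
  qed
qed

lemma feasible_assignment_schedule:
  assumes valid: "I \<in> valid_instances" and a: "\<And>j. j < length I \<Longrightarrow> a j < m"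
  shows "feasible m I (assignment_schedule I a)"
proof -
  let ?\<sigma> = "assignment_schedule I a"
  have jobs: "map the_job ?\<sigma> = assignment_order I a"
    by (simp add: assignment_schedule_def o_def)
  have "sorted_wrt (\<lambda>d e. the_machine d = the_machine e \<longrightarrow>
      the_start d + duration I d \<le> the_start e) ?\<sigma>"
    using assignment_order_no_overlap[OF valid, of a]
    by (simp add: assignment_schedule_def sorted_wrt_map)
  then have "\<forall>k<length ?\<sigma>. \<forall>i<k. the_machine (?\<sigma> ! i) = the_machine (?\<sigma> ! k) \<longrightarrow>
      the_start (?\<sigma> ! i) + duration I (?\<sigma> ! i) \<le> the_start (?\<sigma> ! k)"
    by (simp add: sorted_wrt_iff_nth_less)
  moreover have "sorted (map the_start ?\<sigma>)"
    using sorted_assignment_order[of I a]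
    by (auto simp: assignment_schedule_def sorted_wrt_map o_def elim: sorted_wrt_mono_rel[rotated])
  moreover have "the_machine d < m \<and> 0 \<le> the_start d" if "d \<in> set ?\<sigma>" for d
    using that a valid by (auto simp: assignment_schedule_def assigned_start_nonneg)
  ultimately show ?thesis
    by (auto simp: feasible_def jobs)
qed

lemma machine_load_assignment_schedule:
  "machine_load I (assignment_schedule I a) i =
     (\<Sum>j | j < length I \<and> a j = i. offline_time (I ! j))"
proof -
  have "machine_load I (assignment_schedule I a) i =
      (\<Sum>j\<leftarrow>filter (\<lambda>j. a j = i) (assignment_order I a). offline_time (I ! j))"
    by (simp add: machine_load_def assignment_schedule_def filter_map o_def)
  then show ?thesis
    by (simp add: sum_list_distinct_conv_sum_set Collect_conj_eq lessThan_def Int_commute)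
qed

lemma opt_le_assignment:
  assumes "m \<ge> 1" "I \<in> valid_instances" "\<And>j. j < length I \<Longrightarrow> a j < m"
    and "\<And>i. i < m \<Longrightarrow> (\<Sum>j | j < length I \<and> a j = i. offline_time (I ! j)) \<le> b"
  shows "opt m I \<le> b"
proof -
  have "opt m I \<le> makespan m I (assignment_schedule I a)"
    using assms by (intro opt_le_makespan feasible_assignment_schedule)
  also have "\<dots> \<le> b"
    using assms by (simp add: makespan_le_iff machine_load_assignment_schedule)
  finally show ?thesis .
qed

lemma opt_le_one_long_job:
  assumes m: "m \<ge> 1" and valid: "I \<in> valid_instances" and j: "j < length I"
    and len: "length I \<le> k * (m - 1) + 1"
    and long: "offline_time (I ! j) \<le> real k * r"
    and short: "\<And>i. i < length I \<Longrightarrow> i \<noteq> j \<Longrightarrow> offline_time (I ! i) \<le> r"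
    and r: "0 \<le> r"
  shows "opt m I \<le> real k * r"
proof -
  let ?X = "{..<length I} - {j}"
  have "finite ?X" "card ?X \<le> k * (m - 1)"
    using j len by simp_all
  then obtain f where f: "\<And>i. i \<in> ?X \<Longrightarrow> f i < m - 1"
      "\<And>q. card {i \<in> ?X. f i = q} \<le> k"
    using exists_balanced_map by blast
  define a where "a i = (if i = j then 0 else Suc (f i))" for i
  show ?thesis
  proof (rule opt_le_assignment[OF m valid])
    show "a i < m" if "i < length I" for i
      using f(1)[of i] that m by (auto simp: a_def)
  next
    fix q
    show "(\<Sum>i | i < length I \<and> a i = q. offline_time (I ! i)) \<le> real k * r"
    proof (cases q)
      case 0
      then have "{i. i < length I \<and> a i = q} = {j}"
        using j by (auto simp: a_def split: if_splits)
      then show ?thesis using long by simp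
    next
      case (Suc q')
      then have "{i. i < length I \<and> a i = q} = {i \<in> ?X. f i = q'}"
        by (auto simp: a_def split: if_splits)
      then have "(\<Sum>i | i < length I \<and> a i = q. offline_time (I ! i))
          \<le> real (card {i \<in> ?X. f i = q'}) * r"
        using short by (simp only:) (intro sum_bounded_above, auto)
      also have "\<dots> \<le> real k * r"
        using f(2) r by (intro mult_right_mono) simp_all
      finally show ?thesis .
    qed
  qed
qed


subsection \<open>Processing times that are revealed too late\<close>

lemma online_feasible: "online_algorithm m K A \<Longrightarrow> I \<in> K \<Longrightarrow> feasible m I (A I)"
  by (simp add: online_algorithm_def)

lemma online_prefix_eq:
  assumes online: "online_algorithm m K A"
    and K: "I \<in> K" "I' \<in> K"
    and pub: "public_data I = public_data I'"
    and k: "k < length I"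
    and same: "\<And>d. d \<in> set (take k (A I)) \<Longrightarrow>
      proc_time (I ! the_job d) = proc_time (I' ! the_job d)"
  shows "take (Suc k) (A I) = take (Suc k) (A I')"
proof -
  have "length I = length I'"
    using pub unfolding public_data_def by (metis length_map)
  then have len: "length (A I) = length I" "length (A I') = length I"
    using feasible_length online_feasible[OF online] K by metis+
  have "take l (A I) = take l (A I')" if "l \<le> Suc k" for l
    using that
  proof (induction l)
    case (Suc l)
    then have eq: "take l (A I) = take l (A I')" and l: "l < length I" "l \<le> k"
      using k by auto
    have "set (take l (A I)) \<subseteq> set (take k (A I))"
      using l(2) by (rule set_take_subset_set_take)
    then have "same_revealed I I' (take l (A I)) (the_start (A I ! l))"
      by (auto simp: same_revealed_def intro: same)
    then have "A I ! l = A I' ! l"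
      using online K pub eq l unfolding online_algorithm_def by blast
    then show ?case
      using eq l len by (simp add: take_Suc_conv_app_nth)
  qed simp
  then show ?thesis by simp
qed

definition set_proc_time :: "inst \<Rightarrow> nat \<Rightarrow> real \<Rightarrow> inst" where
  "set_proc_time I j p = I[j := (I ! j)\<lparr>proc_time := p\<rparr>]"

lemma length_set_proc_time [simp]: "length (set_proc_time I j p) = length I"
  by (simp add: set_proc_time_def)

lemma nth_set_proc_time:
  "i < length I \<Longrightarrow>
    set_proc_time I j p ! i = (if i = j then (I ! j)\<lparr>proc_time := p\<rparr> else I ! i)"
  by (simp add: set_proc_time_def nth_list_update)

lemma public_data_set_proc_time: "public_data (set_proc_time I j p) = public_data I"
  by (cases "j < length I") (auto simp: public_data_def nth_set_proc_time intro!: nth_equalityI)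

lemma duration_set_proc_time:
  assumes "the_job d < length I"
  shows "duration (set_proc_time I j p) d =
    duration I d + (if the_job d = j \<and> tested d then p - proc_time (I ! j) else 0)"
  using assms by (simp add: duration_def nth_set_proc_time Let_def)

lemma machine_load_set_proc_time:
  assumes "distinct (map the_job \<sigma>)" "\<And>e. e \<in> set \<sigma> \<Longrightarrow> the_job e < length I"
    and d: "d \<in> set \<sigma>" "tested d"
  shows "machine_load (set_proc_time I (the_job d) p) \<sigma> (the_machine d) =
    machine_load I \<sigma> (the_machine d) + (p - proc_time (I ! the_job d))"
proof -
  let ?I' = "set_proc_time I (the_job d) p"
  obtain \<sigma>\<^sub>1 \<sigma>\<^sub>2 where \<sigma>: "\<sigma> = \<sigma>\<^sub>1 @ d # \<sigma>\<^sub>2"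
    using split_list[OF d(1)] by blast
  then have "the_job d \<notin> the_job ` (set \<sigma>\<^sub>1 \<union> set \<sigma>\<^sub>2)"
    using assms(1) by auto
  then have "the_job e \<noteq> the_job d" if "e \<in> set \<sigma>\<^sub>1 \<union> set \<sigma>\<^sub>2" for e
    using that by (metis imageI)
  then have "duration ?I' e = duration I e" if "e \<in> set \<sigma>\<^sub>1 \<union> set \<sigma>\<^sub>2" for e
    using that assms(2)[of e] \<sigma> by (auto simp: duration_set_proc_time)
  then have "machine_load ?I' \<sigma>\<^sub>1 i = machine_load I \<sigma>\<^sub>1 i"
      "machine_load ?I' \<sigma>\<^sub>2 i = machine_load I \<sigma>\<^sub>2 i" for i
    by (intro machine_load_cong; simp)+
  then show ?thesis
    using assms \<sigma> by (simp add: duration_set_proc_time)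
qed

lemma online_set_proc_time_prefix_eq:
  assumes online: "online_algorithm m K A" and K: "I \<in> K" "set_proc_time I (the_job d) p \<in> K"
    and sched: "A I = \<sigma> @ d # \<sigma>'"
  obtains \<tau> where "A (set_proc_time I (the_job d) p) = \<sigma> @ d # \<tau>"
proof -
  let ?I' = "set_proc_time I (the_job d) p"
  have feas: "feasible m I (A I)"
    using online K(1) by (rule online_feasible)
  have "take (Suc (length \<sigma>)) (A I) = take (Suc (length \<sigma>)) (A ?I')"
  proof (rule online_prefix_eq[OF online K])
    show "length \<sigma> < length I"
      using feasible_length[OF feas] sched by simp
  next
    fix e assume "e \<in> set (take (length \<sigma>) (A I))"
    then have "e \<in> set \<sigma>"
      using sched by simp
    then have "the_job e \<noteq> the_job d"
      using feas sched feasible_append_Cons_job_neq by metis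
    moreover have "the_job e < length I"
      using feasible_job_less[OF feas] \<open>e \<in> set \<sigma>\<close> sched by simp
    ultimately show "proc_time (I ! the_job e) = proc_time (?I' ! the_job e)"
      by (simp add: nth_set_proc_time)
  qed (simp add: public_data_set_proc_time)
  then have "A ?I' = (\<sigma> @ [d]) @ drop (Suc (length \<sigma>)) (A ?I')"
    using sched append_take_drop_id[of "Suc (length \<sigma>)" "A ?I'"] by simp
  then show thesis
    using that by simp
qed

lemma online_makespan_set_proc_time_ge:
  assumes online: "online_algorithm m K A"
    and K: "K \<subseteq> valid_instances" "I \<in> K" "set_proc_time I (the_job d) p \<in> K"
    and sched: "A I = \<sigma> @ d # \<sigma>'" and tested: "tested d"
    and last: "\<And>e. e \<in> set \<sigma>' \<Longrightarrow> the_machine e \<noteq> the_machine d"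
  shows "machine_load I (A I) (the_machine d) + (p - proc_time (I ! the_job d))
    \<le> makespan m (set_proc_time I (the_job d) p) (A (set_proc_time I (the_job d) p))"
proof -
  let ?I' = "set_proc_time I (the_job d) p" and ?i = "the_machine d"
  have feas: "feasible m I (A I)" "feasible m ?I' (A ?I')"
    using online K by (auto intro: online_feasible)
  obtain \<tau> where sched': "A ?I' = \<sigma> @ d # \<tau>"
    using online_set_proc_time_prefix_eq[OF online K(2,3) sched] .
  have "machine_load I (A I) ?i + (p - proc_time (I ! the_job d))
      = machine_load I (\<sigma> @ [d]) ?i + (p - proc_time (I ! the_job d))"
    using sched machine_load_eq_0[of \<sigma>' ?i I, OF last] by simp
  also have "\<dots> = machine_load ?I' (\<sigma> @ [d]) ?i"
    using feas(1) sched tested feasible_job_less[OF feas(1)]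
    by (intro machine_load_set_proc_time[symmetric]) (auto simp: feasible_def)
  also have "\<dots> \<le> machine_load ?I' (\<sigma> @ [d]) ?i + machine_load ?I' \<tau> ?i"
    using K sched' feasible_duration_nonneg[OF _ feas(2)]
    by (simp add: machine_load_nonneg subset_iff)
  also have "\<dots> = machine_load ?I' (A ?I') ?i"
    using sched' by simp
  also have "\<dots> \<le> makespan m ?I' (A ?I')"
    using feasible_machine_less[OF feas(1), of d] sched
    by (intro machine_load_le_makespan) simp
  finally show ?thesis .
qed

text \<open>The job in question is the last one placed on machine \<open>i\<close>: its processing time cannot
  influence anything that happens on this machine before.\<close>

lemma online_hidden_job:
  assumes online: "online_algorithm m K A" and K: "K \<subseteq> valid_instances" "I \<in> K"
    and i: "i \<in> the_machine ` set (A I)"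
    and tested: "\<And>d. d \<in> set (A I) \<Longrightarrow> the_machine d = i \<Longrightarrow> tested d"
  obtains j where "j < length I"
    and "\<And>p. set_proc_time I j p \<in> K \<Longrightarrow>
      machine_load I (A I) i + (p - proc_time (I ! j))
        \<le> makespan m (set_proc_time I j p) (A (set_proc_time I j p))"
proof -
  have "\<exists>d\<in>set (A I). the_machine d = i"
    using i by blast
  then obtain \<sigma> d \<sigma>' where sched: "A I = \<sigma> @ d # \<sigma>'" and d: "the_machine d = i"
      and last: "\<And>e. e \<in> set \<sigma>' \<Longrightarrow> the_machine e \<noteq> i"
    using split_list_last_prop[of "A I" "\<lambda>d. the_machine d = i"] by blast
  have mem: "d \<in> set (A I)"
    using sched by simp
  show thesis
  proof (rule that)
    show "the_job d < length I"
      using feasible_job_less[OF online_feasible[OF online K(2)] mem] .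
    show "machine_load I (A I) i + (p - proc_time (I ! the_job d))
        \<le> makespan m (set_proc_time I (the_job d) p) (A (set_proc_time I (the_job d) p))"
      if "set_proc_time I (the_job d) p \<in> K" for p
      using online_makespan_set_proc_time_ge[OF online K that sched] tested[OF mem d] last
      unfolding d by blast
  qed
qed


subsection \<open>The adversary\<close>

definition adversary :: "nat \<Rightarrow> inst" where
  "adversary m = replicate (m * (m - 1) + 1)
     \<lparr>test_time = 1, upper_bound = 2 * real m, proc_time = 0\<rparr>"

lemma length_adversary [simp]: "length (adversary m) = m * (m - 1) + 1"
  by (simp add: adversary_def)

lemma nth_adversary:
  "i < m * (m - 1) + 1 \<Longrightarrow>
    adversary m ! i = \<lparr>test_time = 1, upper_bound = 2 * real m, proc_time = 0\<rparr>"
  unfolding adversary_def by (rule nth_replicate)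

lemma adversary_eq_set_proc_time: "adversary m = set_proc_time (adversary m) 0 0"
  by (simp add: adversary_def set_proc_time_def)

lemma set_proc_time_adversary_unit_test:
  assumes "0 \<le> p" "p \<le> 2 * real m"
  shows "set_proc_time (adversary m) j p \<in> unit_test_instances"
  using assms
  by (auto simp: unit_test_instances_def valid_instances_def in_set_conv_nth nth_set_proc_time
      nth_adversary)

lemma adversary_unit_test: "adversary m \<in> unit_test_instances"
  using set_proc_time_adversary_unit_test[of 0 m 0] by (simp flip: adversary_eq_set_proc_time)

lemma opt_set_proc_time_adversary_le:
  assumes "m \<ge> 1" "j < m * (m - 1) + 1" "0 \<le> p" "p \<le> real m - 1"
  shows "opt m (set_proc_time (adversary m) j p) \<le> real m"
proof -
  have "set_proc_time (adversary m) j p \<in> valid_instances"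
    using assms set_proc_time_adversary_unit_test[of p m j] unit_test_instances_subset_valid
    by auto
  then have "opt m (set_proc_time (adversary m) j p) \<le> real m * 1"
    using assms
    by (intro opt_le_one_long_job[where j = j])
      (auto simp: nth_set_proc_time nth_adversary offline_time_def)
  then show ?thesis by simp
qed

lemma untested_adversary_makespan:
  assumes feas: "feasible m (adversary m) \<sigma>" and d: "d \<in> set \<sigma>" "\<not> tested d"
  shows "2 * real m \<le> makespan m (adversary m) \<sigma>"
proof -
  have "adversary m \<in> valid_instances"
    using adversary_unit_test unit_test_instances_subset_valid by blast
  then have "duration (adversary m) d \<le> makespan m (adversary m) \<sigma>"
    using feas d(1) by (rule duration_le_makespan)
  moreover have "the_job d < m * (m - 1) + 1"
    using feasible_job_less[OF feas d(1)] by simp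
  ultimately show ?thesis
    using d(2) by (simp add: duration_def nth_adversary)
qed

lemma tested_adversary_busy_machine:
  assumes feas: "feasible m (adversary m) \<sigma>" and m: "m \<ge> 1"
    and tested: "\<And>d. d \<in> set \<sigma> \<Longrightarrow> tested d"
  obtains i where "i \<in> the_machine ` set \<sigma>" "real m \<le> machine_load (adversary m) \<sigma> i"
proof -
  have "set (map the_machine \<sigma>) \<subseteq> {..<m}"
    using feasible_machine_less[OF feas] by auto
  moreover have "(m - 1) * card {..<m} < length (map the_machine \<sigma>)"
    using feasible_length[OF feas] by (simp add: mult.commute)
  ultimately obtain i where i: "m - 1 < count_list (map the_machine \<sigma>) i"
    using pigeonhole_count_list[of "map the_machine \<sigma>" "{..<m}" "m - 1"] by auto
  have "duration (adversary m) d = 1" if "d \<in> set \<sigma>" for d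
    using tested[OF that] feasible_job_less[OF feas that]
    by (simp add: duration_def nth_adversary)
  then have "real (count_list (map the_machine \<sigma>) i) * 1 \<le> machine_load (adversary m) \<sigma> i"
    by (intro count_list_mult_le_machine_load) simp
  then have "real m \<le> machine_load (adversary m) \<sigma> i"
    using i by linarith
  moreover have "i \<in> the_machine ` set \<sigma>"
    using i count_notin[of i "map the_machine \<sigma>"] by fastforce
  ultimately show thesis
    using that by blast
qed

lemma online_adversary_makespan:
  assumes m: "m \<ge> 1" and K: "unit_test_instances \<subseteq> K" "K \<subseteq> valid_instances"
    and online: "online_algorithm m K A"
  obtains I where "I \<in> unit_test_instances" "opt m I \<le> real m"
    "2 * real m - 1 \<le> makespan m I (A I)"
proof -
  let ?I = "adversary m"
  have I: "?I \<in> unit_test_instances"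
    by (rule adversary_unit_test)
  have feas: "feasible m ?I (A ?I)"
    using online_feasible[OF online] I K(1) by blast
  show thesis
  proof (cases "\<forall>d\<in>set (A ?I). tested d")
    case True
    then obtain i where i: "i \<in> the_machine ` set (A ?I)"
        and load: "real m \<le> machine_load ?I (A ?I) i"
      using tested_adversary_busy_machine[OF feas m] by blast
    obtain j where j: "j < length ?I"
        and hidden: "\<And>p. set_proc_time ?I j p \<in> K \<Longrightarrow>
          machine_load ?I (A ?I) i + (p - proc_time (?I ! j))
            \<le> makespan m (set_proc_time ?I j p) (A (set_proc_time ?I j p))"
      using online_hidden_job[OF online K(2) _ i] I K(1) True by blast
    let ?J = "set_proc_time ?I j (real m - 1)"
    have J: "?J \<in> unit_test_instances"
      using m by (intro set_proc_time_adversary_unit_test) auto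
    moreover have "opt m ?J \<le> real m"
      using m j by (intro opt_set_proc_time_adversary_le) auto
    moreover have "2 * real m - 1 \<le> makespan m ?J (A ?J)"
      using hidden[of "real m - 1"] load j J K(1) by (auto simp: nth_adversary)
    ultimately show thesis
      by (rule that)
  next
    case False
    then have "2 * real m \<le> makespan m ?I (A ?I)"
      using untested_adversary_makespan[OF feas] by blast
    moreover have "opt m ?I \<le> real m"
      using opt_set_proc_time_adversary_le[of m 0 0] m
      by (simp flip: adversary_eq_set_proc_time)
    ultimately show thesis
      using that[OF I] by simp
  qed
qed

lemma competitive_makespan_le:
  assumes "competitive m K c A" "I \<in> K" "0 \<le> opt m I" "opt m I \<le> b" "0 < makespan m I (A I)"
  shows "makespan m I (A I) \<le> c * b"
proof -
  have le: "makespan m I (A I) \<le> c * opt m I"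
    using assms(1,2) by (simp add: competitive_def)
  then have "0 < c * opt m I"
    using assms(5) by linarith
  then have "0 < c"
    using assms(3) by (simp add: zero_less_mult_iff)
  then have "c * opt m I \<le> c * b"
    using assms(4) by simp
  with le show ?thesis by simp
qed

lemma online_competitive_ratio_ge:
  assumes m: "m \<ge> 1" and K: "unit_test_instances \<subseteq> K" "K \<subseteq> valid_instances"
    and online: "online_algorithm m K A" and comp: "competitive m K c A"
  shows "2 - 1 / real m \<le> c"
proof -
  obtain I where I: "I \<in> unit_test_instances" and opt: "opt m I \<le> real m"
      and alg: "2 * real m - 1 \<le> makespan m I (A I)"
    using online_adversary_makespan[OF m K online] .
  have "I \<in> K" "I \<in> valid_instances"
    using I K by auto
  then have "0 \<le> opt m I"
    using m online by (intro opt_nonneg[of _ _ "A I"] online_feasible)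
  then have "makespan m I (A I) \<le> c * real m"
    using comp \<open>I \<in> K\<close> opt alg m by (intro competitive_makespan_le) auto
  then show ?thesis
    using alg m by (simp add: field_simps)
qed

theorem theorem1:
  fixes m :: nat and c :: real
  assumes "m \<ge> 1" and "c < 2 - 1 / real m"
  shows "(\<nexists>A. online_algorithm m valid_instances A \<and> competitive m valid_instances c A) \<and>
         (\<nexists>A. online_algorithm m unit_test_instances A \<and> competitive m unit_test_instances c A)"
proof -
  have "\<not> (online_algorithm m K A \<and> competitive m K c A)"
    if "unit_test_instances \<subseteq> K" "K \<subseteq> valid_instances" for K A
    using online_competitive_ratio_ge[OF assms(1) that] assms(2) by force
  then show ?thesis
    using unit_test_instances_subset_valid by blast
qed

end
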